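(* $(\mathbb{Q}[\mu]\langle Y\rangle,\ast_\mu)$ is a commutative and associative $\mathbb{Q}[\mu]$-algebra with unit $1$.
   Context: Fix $\mu\in\mathbb{C}$ with $\mathrm{Re}(\mu)>0$; $\mathbb{Q}[\mu]\subset\mathbb{C}$ the ring generated by $\mu$. $Y=\{y_{k,m}:k\in\mathbb{N},m\in\mathbb{Q}_{>0}\}$; $\mathbb{Q}[\mu]\langle Y\rangle$ is the free $\mathbb{Q}[\mu]$-module on all words over $Y$ (empty word $1$), with concatenation. On the span of letters define the bilinear product $\odot$: $y_{k_1,m}\odot y_{k_2,m}=y_{k_1+k_2,m}$, and for $m_1\ne m_2$, $y_{k_1,m_1}\odot y_{k_2,m_2}=\sum_{i=1}^{k_1}a_iy_{i,m_1}+\sum_{j=1}^{k_2}b_jy_{j,m_2}$ with $\frac{1}{(x+m_1)^{k_1}(x+m_2)^{k_2}}=\sum_{i}\frac{a_i}{(x+m_1)^i}+\sum_j\frac{b_j}{(x+m_2)^j}$. The $\mu$-stuffle product $\ast_\mu$ is the $\mathbb{Q}[\mu]$-bilinear map on $\mathbb{Q}[\mu]\langle Y\rangle$ defined recursively by $1\ast_\mu w=w\ast_\mu1=w$ for all words $w$ and $ux\ast_\mu vy=(u\ast_\mu vy)x+(ux\ast_\mu v)y-\mu\,(u\ast_\mu v)(x\odot y)$ for letters $x,y\in Y$ and words $u,v$ (concatenation extended bilinearly). *)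

theory Defs
  imports
    Complex_Main
    "HOL-Algebra.Module"
    "HOL-Library.Poly_Mapping"
    "HOL-Computational_Algebra.Polynomial"
begin

type_synonym letter = "nat \<times> rat"
type_synonym word = "letter list"

text \<open>The pair \<open>(k, m)\<close> stands for $y_{k,m}$. Here $\mathbb{N}$ starts at $1$: for $k_1 = k_2 = 0$ the
  partial fraction decomposition below would not exist.\<close>

definition Y :: "letter set" where
  "Y = {(k, m). 1 \<le> k \<and> 0 < m}"

definition Qmu :: "complex \<Rightarrow> complex set" where
  "Qmu \<mu> = {poly p \<mu> | p. \<forall>i. coeff p i \<in> \<rat>}"

definition Qmu_ring :: "complex \<Rightarrow> complex ring" where
  "Qmu_ring \<mu> = \<lparr>carrier = Qmu \<mu>, monoid.mult = (*), one = 1, zero = 0, add = (+)\<rparr>"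

text \<open>Products are defined on finitely supported complex combinations of arbitrary lists;
  the free module $\mathbb{Q}[\mu]\langle Y\rangle$ is the following subset.\<close>

definition QmuY :: "complex \<Rightarrow> (word \<Rightarrow>\<^sub>0 complex) set" where
  "QmuY \<mu> = {p. Poly_Mapping.keys p \<subseteq> lists Y \<and> (\<forall>w. Poly_Mapping.lookup p w \<in> Qmu \<mu>)}"

definition scale :: "complex \<Rightarrow> (word \<Rightarrow>\<^sub>0 complex) \<Rightarrow> (word \<Rightarrow>\<^sub>0 complex)" where
  "scale c p = Poly_Mapping.map ((*) c) p"

definition word_elem :: "word \<Rightarrow> (word \<Rightarrow>\<^sub>0 complex)" where
  "word_elem w = Poly_Mapping.single w 1"

definition bilinear_ext ::
  "(word \<Rightarrow> word \<Rightarrow> (word \<Rightarrow>\<^sub>0 complex)) \<Rightarrow>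
   (word \<Rightarrow>\<^sub>0 complex) \<Rightarrow> (word \<Rightarrow>\<^sub>0 complex) \<Rightarrow> (word \<Rightarrow>\<^sub>0 complex)" where
  "bilinear_ext f p q =
     (\<Sum>u\<in>Poly_Mapping.keys p. \<Sum>v\<in>Poly_Mapping.keys q.
        scale (Poly_Mapping.lookup p u * Poly_Mapping.lookup q v) (f u v))"

definition conc ::
  "(word \<Rightarrow>\<^sub>0 complex) \<Rightarrow> (word \<Rightarrow>\<^sub>0 complex) \<Rightarrow> (word \<Rightarrow>\<^sub>0 complex)" where
  "conc = bilinear_ext (\<lambda>u v. word_elem (u @ v))"

text \<open>Coefficients are required to vanish outside the summation range so that the pair is unique.
  An identity of rational functions over $\mathbb{Q}$ is the same as equality at all rational points
  other than the poles.\<close>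

definition is_partial_fraction ::
  "nat \<Rightarrow> rat \<Rightarrow> nat \<Rightarrow> rat \<Rightarrow> (nat \<Rightarrow> rat) \<Rightarrow> (nat \<Rightarrow> rat) \<Rightarrow> bool" where
  "is_partial_fraction k1 m1 k2 m2 a b \<longleftrightarrow>
     (\<forall>i. i \<notin> {1..k1} \<longrightarrow> a i = 0) \<and>
     (\<forall>j. j \<notin> {1..k2} \<longrightarrow> b j = 0) \<and>
     (\<forall>x. x \<noteq> - m1 \<and> x \<noteq> - m2 \<longrightarrow>
        1 / ((x + m1) ^ k1 * (x + m2) ^ k2) =
        (\<Sum>i=1..k1. a i / (x + m1) ^ i) + (\<Sum>j=1..k2. b j / (x + m2) ^ j))"

definition partial_fraction ::
  "nat \<Rightarrow> rat \<Rightarrow> nat \<Rightarrow> rat \<Rightarrow> (nat \<Rightarrow> rat) \<times> (nat \<Rightarrow> rat)" where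
  "partial_fraction k1 m1 k2 m2 = (THE (a, b). is_partial_fraction k1 m1 k2 m2 a b)"

text \<open>The product $\odot$ of two letters, a linear combination of one-letter words.\<close>

fun letter_prod :: "letter \<Rightarrow> letter \<Rightarrow> (word \<Rightarrow>\<^sub>0 complex)" where
  "letter_prod (k1, m1) (k2, m2) =
     (if m1 = m2 then word_elem [(k1 + k2, m1)]
      else let (a, b) = partial_fraction k1 m1 k2 m2 in
        (\<Sum>i=1..k1. scale (of_rat (a i)) (word_elem [(i, m1)])) +
        (\<Sum>j=1..k2. scale (of_rat (b j)) (word_elem [(j, m2)])))"

function stuffle_word :: "complex \<Rightarrow> word \<Rightarrow> word \<Rightarrow> (word \<Rightarrow>\<^sub>0 complex)" where
  "stuffle_word \<mu> [] w = word_elem w"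
| "stuffle_word \<mu> (u @ [x]) [] = word_elem (u @ [x])"
| "stuffle_word \<mu> (u @ [x]) (v @ [y]) =
     conc (stuffle_word \<mu> u (v @ [y])) (word_elem [x]) +
     conc (stuffle_word \<mu> (u @ [x]) v) (word_elem [y]) -
     scale \<mu> (conc (stuffle_word \<mu> u v) (letter_prod x y))"
  by (metis prod_cases3 rev_exhaust) simp_all
termination
  by (relation "measure (\<lambda>(\<mu>, u, v). length u + length v)") auto

definition stuffle ::
  "complex \<Rightarrow> (word \<Rightarrow>\<^sub>0 complex) \<Rightarrow> (word \<Rightarrow>\<^sub>0 complex) \<Rightarrow> (word \<Rightarrow>\<^sub>0 complex)" where
  "stuffle \<mu> = bilinear_ext (stuffle_word \<mu>)"

definition stuffle_algebra :: "complex \<Rightarrow> (complex, word \<Rightarrow>\<^sub>0 complex) module" where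
  "stuffle_algebra \<mu> =
     \<lparr>carrier = QmuY \<mu>, monoid.mult = stuffle \<mu>, one = word_elem [], zero = 0, add = (+),
      module.smult = scale\<rparr>"

end

theory Submission
  imports Defs
begin

text \<open>Sending the letter \<open>y\<^sub>k\<^sub>,\<^sub>m\<close> to the function \<open>1 / (x + m)\<^sup>k\<close> turns \<open>\<odot>\<close> into the pointwise
  product, and these functions are linearly independent; hence \<open>\<odot>\<close> is commutative and associative.
  The recursion of the stuffle product extends bilinearly from letters to the span of the letters.
  Expanding both \<open>(ux \<ast> vy) \<ast> wz\<close> and \<open>ux \<ast> (vy \<ast> wz)\<close> with it, the terms correspond to each other
  by induction on the total length and by associativity of \<open>\<odot>\<close>.\<close>

section \<open>Linear extension\<close>

lemma lookup_scale [simp]: "Poly_Mapping.lookup (scale c p) w = c * Poly_Mapping.lookup p w"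
  by (simp add: scale_def map.rep_eq when_def)

lemma scale_add_right: "scale c (p + q) = scale c p + scale c q"
  by (rule poly_mapping_eqI) (simp add: lookup_add algebra_simps)

lemma scale_diff_right: "scale c (p - q) = scale c p - scale c q"
  by (rule poly_mapping_eqI) (simp add: lookup_minus algebra_simps)

lemma scale_add_left: "scale (c + d) p = scale c p + scale d p"
  by (rule poly_mapping_eqI) (simp add: lookup_add algebra_simps)

lemma scale_scale [simp]: "scale c (scale d p) = scale (c * d) p"
  by (rule poly_mapping_eqI) (simp add: algebra_simps)

lemma scale_one [simp]: "scale 1 p = p"
  by (rule poly_mapping_eqI) simp

lemma scale_zero_left [simp]: "scale 0 p = 0"
  by (rule poly_mapping_eqI) simp

lemma scale_zero_right [simp]: "scale c 0 = 0"
  by (rule poly_mapping_eqI) simp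

lemma scale_sum_right: "scale c (sum f A) = (\<Sum>a\<in>A. scale c (f a))"
  by (rule poly_mapping_eqI) (simp add: lookup_sum sum_distrib_left)

lemma keys_scale_subset: "Poly_Mapping.keys (scale c p) \<subseteq> Poly_Mapping.keys p"
  by (auto simp: in_keys_iff)

definition linear_functional :: "(word \<Rightarrow> complex) \<Rightarrow> (word \<Rightarrow>\<^sub>0 complex) \<Rightarrow> complex" where
  "linear_functional g p =
     (\<Sum>w\<in>Poly_Mapping.keys p. Poly_Mapping.lookup p w * g w)"

text \<open>Cancellation can shrink the support of a sum, so additivity needs a common finite index
  set.\<close>

lemma linear_functional_superset:
  assumes "finite A" "Poly_Mapping.keys p \<subseteq> A"
  shows "linear_functional g p = (\<Sum>w\<in>A. Poly_Mapping.lookup p w * g w)"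
  unfolding linear_functional_def
  by (rule sum.mono_neutral_left) (use assms in \<open>auto simp: in_keys_iff\<close>)

lemma linear_functional_add:
  "linear_functional g (p + q) = linear_functional g p + linear_functional g q"
proof -
  let ?A = "Poly_Mapping.keys p \<union> Poly_Mapping.keys q"
  have "linear_functional g r = (\<Sum>w\<in>?A. Poly_Mapping.lookup r w * g w)"
    if "r \<in> {p, q, p + q}" for r
    by (rule linear_functional_superset) (use that keys_add[of p q] in auto)
  then show ?thesis
    by (simp add: lookup_add sum.distrib algebra_simps)
qed

lemma linear_functional_scale:
  "linear_functional g (scale c p) = c * linear_functional g p"
  by (subst linear_functional_superset[OF _ keys_scale_subset])
    (simp_all add: linear_functional_def sum_distrib_left mult.assoc)

lemma linear_functional_zero [simp]: "linear_functional g 0 = 0"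
  by (simp add: linear_functional_def)

lemma linear_functional_sum:
  "linear_functional g (sum f A) = (\<Sum>a\<in>A. linear_functional g (f a))"
  by (induction A rule: infinite_finite_induct) (simp_all add: linear_functional_add)

lemma linear_functional_word_elem [simp]: "linear_functional g (word_elem w) = g w"
  by (simp add: linear_functional_def word_elem_def)

text \<open>Linearity is over the complex numbers: identities are proved in the ambient complex
  space, and membership in the free module over \<open>Qmu \<mu>\<close> is treated
  separately.\<close>

definition lin :: "((word \<Rightarrow>\<^sub>0 complex) \<Rightarrow> (word \<Rightarrow>\<^sub>0 complex)) \<Rightarrow> bool" where
  "lin f \<longleftrightarrow> (\<forall>p q. f (p + q) = f p + f q) \<and> (\<forall>c p. f (scale c p) = scale c (f p))"

lemma lin_add: "lin f \<Longrightarrow> f (p + q) = f p + f q"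
  and lin_scale: "lin f \<Longrightarrow> f (scale c p) = scale c (f p)"
  by (simp_all add: lin_def)

lemma lin_zero: "lin f \<Longrightarrow> f 0 = 0"
  using lin_scale[of f 0 0] by simp

lemma lin_diff: "lin f \<Longrightarrow> f (p - q) = f p - f q"
  using lin_add[of f "p - q" q] by (simp add: algebra_simps)

lemma lin_sum: "lin f \<Longrightarrow> f (sum g A) = (\<Sum>a\<in>A. f (g a))"
  by (induction A rule: infinite_finite_induct) (simp_all add: lin_zero lin_add)

lemma word_expansion:
  "p = (\<Sum>w\<in>Poly_Mapping.keys p. scale (Poly_Mapping.lookup p w) (word_elem w))"
proof (rule poly_mapping_eqI)
  fix v
  have "(\<Sum>w\<in>Poly_Mapping.keys p. Poly_Mapping.lookup p w * Poly_Mapping.lookup (word_elem w) v)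
      = (\<Sum>w\<in>Poly_Mapping.keys p. if w = v then Poly_Mapping.lookup p v else 0)"
    by (rule sum.cong) (auto simp: word_elem_def lookup_single)
  then show "Poly_Mapping.lookup p v =
      Poly_Mapping.lookup (\<Sum>w\<in>Poly_Mapping.keys p. scale (Poly_Mapping.lookup p w) (word_elem w)) v"
    by (simp add: lookup_sum in_keys_iff)
qed

text \<open>Only words in the support of \<open>p\<close> have to be compared, so identities known
  only for words over \<open>Y\<close>, or only for one-letter words, still extend.\<close>

lemma lin_eqI:
  assumes "lin f" "lin g"
    and "\<And>w. w \<in> Poly_Mapping.keys p \<Longrightarrow> f (word_elem w) = g (word_elem w)"
  shows "f p = g p"
proof -
  have "f p = (\<Sum>w\<in>Poly_Mapping.keys p. scale (Poly_Mapping.lookup p w) (f (word_elem w)))"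
    by (subst word_expansion) (simp add: lin_sum lin_scale assms)
  also have "\<dots> = (\<Sum>w\<in>Poly_Mapping.keys p. scale (Poly_Mapping.lookup p w) (g (word_elem w)))"
    using assms(3) by (intro sum.cong) simp_all
  also have "\<dots> = g p"
    by (subst (3) word_expansion) (simp add: lin_sum lin_scale assms)
  finally show ?thesis .
qed

definition linear_ext :: "(word \<Rightarrow> (word \<Rightarrow>\<^sub>0 complex)) \<Rightarrow> (word \<Rightarrow>\<^sub>0 complex) \<Rightarrow> (word \<Rightarrow>\<^sub>0 complex)" where
  "linear_ext g p = (\<Sum>w\<in>Poly_Mapping.keys p. scale (Poly_Mapping.lookup p w) (g w))"

text \<open>Each coefficient is a linear functional of \<open>p\<close>; the linearity of
  \<open>linear_ext g\<close> is inherited from there.\<close>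

lemma lookup_linear_ext:
  "Poly_Mapping.lookup (linear_ext g p) v = linear_functional (\<lambda>w. Poly_Mapping.lookup (g w) v) p"
  by (simp add: linear_ext_def linear_functional_def lookup_sum)

lemma lin_linear_ext: "lin (linear_ext g)"
  unfolding lin_def
  by (auto intro!: poly_mapping_eqI
      simp: lookup_linear_ext lookup_add linear_functional_add linear_functional_scale)

lemma linear_ext_word_elem [simp]: "linear_ext g (word_elem w) = g w"
  by (simp add: linear_ext_def word_elem_def)

lemma bilinear_ext_left: "bilinear_ext f p q = linear_ext (\<lambda>u. linear_ext (f u) q) p"
  by (simp add: bilinear_ext_def linear_ext_def scale_sum_right)

text \<open>Interchanging the two sums makes linearity in the second argument another instance of
  \<open>lin_linear_ext\<close>.\<close>

lemma bilinear_ext_right: "bilinear_ext f p q = linear_ext (\<lambda>v. linear_ext (\<lambda>u. f u v) p) q"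
  unfolding bilinear_ext_def linear_ext_def scale_sum_right
  by (subst sum.swap) (simp add: mult.commute)

lemma bilinear_ext_word_elem [simp]: "bilinear_ext f (word_elem u) (word_elem v) = f u v"
  by (simp add: bilinear_ext_left)

lemma lin_bilinear_ext_left: "lin (\<lambda>p. bilinear_ext f p q)"
  unfolding bilinear_ext_left by (rule lin_linear_ext)

lemma lin_bilinear_ext_right: "lin (bilinear_ext f p)"
  unfolding bilinear_ext_right by (rule lin_linear_ext)

lemma lin_intros:
  "lin (\<lambda>p. p)"
  "lin f \<Longrightarrow> lin g \<Longrightarrow> lin (\<lambda>p. f p + g p)"
  "lin f \<Longrightarrow> lin g \<Longrightarrow> lin (\<lambda>p. f p - g p)"
  "lin f \<Longrightarrow> lin (\<lambda>p. scale c (f p))"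
  "lin f \<Longrightarrow> lin (\<lambda>p. bilinear_ext b (f p) q)"
  "lin f \<Longrightarrow> lin (\<lambda>p. bilinear_ext b q (f p))"
  by (auto simp: lin_def scale_add_right scale_diff_right algebra_simps
      lin_add[OF lin_bilinear_ext_left] lin_add[OF lin_bilinear_ext_right]
      lin_scale[OF lin_bilinear_ext_left] lin_scale[OF lin_bilinear_ext_right])

lemmas bilinear_ext_simps =
  lin_add[OF lin_bilinear_ext_left] lin_add[OF lin_bilinear_ext_right]
  lin_diff[OF lin_bilinear_ext_left] lin_diff[OF lin_bilinear_ext_right]
  lin_scale[OF lin_bilinear_ext_left] lin_scale[OF lin_bilinear_ext_right]

section \<open>Partial fractions\<close>

text \<open>If the coefficient of the highest power at a node \<open>m\<close> is nonzero, clear denominators by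
  exactly this power of \<open>x + m\<close> (and high powers of the other factors); at \<open>x = - m\<close> only that
  coefficient survives.\<close>

lemma inverse_powers_independent:
  fixes c :: "letter \<Rightarrow> 'a::field_char_0"
  assumes fin: "finite S" and inf: "infinite X"
    and pos: "\<And>k m. (k, m) \<in> S \<Longrightarrow> 1 \<le> k"
    and nonpole: "\<And>x k m. x \<in> X \<Longrightarrow> (k, m) \<in> S \<Longrightarrow> x + of_rat m \<noteq> 0"
    and zero: "\<And>x. x \<in> X \<Longrightarrow> (\<Sum>s\<in>S. c s / (x + of_rat (snd s)) ^ fst s) = 0"
    and "s \<in> S"
  shows "c s = 0"
proof (rule ccontr)
  assume "c s \<noteq> 0"
  \<comment> \<open>Zero coefficients are discarded so that the largest exponent at
    \<open>m0\<close> belongs to a nonzero coefficient.\<close>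
  define T where "T = {t \<in> S. c t \<noteq> 0}"
  have finT: "finite T" and "s \<in> T"
    using fin \<open>s \<in> S\<close> \<open>c s \<noteq> 0\<close> by (simp_all add: T_def)
  define m0 where "m0 = snd s"
  define K where "K = fst ` {t \<in> T. snd t = m0}"
  define k where "k = Max K"
  have "finite K"
    using finT by (simp add: K_def)
  moreover have "fst s \<in> K"
    using \<open>s \<in> T\<close> by (simp add: K_def m0_def)
  ultimately have "k \<in> K"
    unfolding k_def by (intro Max_in) auto
  then have k: "(k, m0) \<in> T"
    by (auto simp: K_def)
  have k_max: "j \<le> k" if "(j, m0) \<in> T" for j
    unfolding k_def by (rule Max_ge[OF \<open>finite K\<close>]) (use that in \<open>force simp: K_def\<close>)
  define M where "M = snd ` T - {m0}"
  have finM: "finite M"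
    using finT by (simp add: M_def)
  define N where "N = Max (fst ` T)"
  have N: "j \<le> N" if "(j, m) \<in> T" for j m
    unfolding N_def by (rule Max_ge) (use finT that in force)+
  define l :: "rat \<Rightarrow> 'a poly" where "l m = [:of_rat m, 1:]" for m
  have poly_l: "poly (l m) x = x + of_rat m" for m x
    by (simp add: l_def add.commute)
  \<comment> \<open>A common denominator with multiplicity exactly \<open>k\<close> at
    \<open>m0\<close>; at the other nodes the crude bound \<open>N\<close> on all exponents is
    enough.\<close>
  define D where "D = l m0 ^ k * (\<Prod>m\<in>M. l m ^ N)"
  \<comment> \<open>For \<open>(j, m)\<close> in \<open>T\<close> this is \<open>D\<close> divided
    by \<open>l m ^ j\<close>, written as a product to avoid division of polynomials.\<close>
  define Q where "Q = (\<lambda>(j, m). if m = m0 then l m0 ^ (k - j) * (\<Prod>m\<in>M. l m ^ N)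
      else l m0 ^ k * (l m ^ (N - j) * (\<Prod>m'\<in>M - {m}. l m' ^ N)))"
  have D: "D = l m ^ j * Q (j, m)" if t: "(j, m) \<in> T" for j m
  proof (cases "m = m0")
    case True
    have "l m0 ^ k = l m0 ^ j * l m0 ^ (k - j)"
      using k_max[of j] t True by (simp flip: power_add)
    with True show ?thesis
      by (simp add: D_def Q_def mult.assoc)
  next
    case False
    then have "m \<in> M"
      using t by (force simp: M_def)
    then have "(\<Prod>m\<in>M. l m ^ N) = l m ^ N * (\<Prod>m'\<in>M - {m}. l m' ^ N)"
      using finM by (rule prod.remove[rotated])
    moreover have "l m ^ N = l m ^ j * l m ^ (N - j)"
      using N[OF t] by (simp flip: power_add)
    ultimately show ?thesis
      using False by (simp add: D_def Q_def mult_ac)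
  qed
  \<comment> \<open>The numerator after clearing denominators; it vanishes on the infinite set
    \<open>X\<close>, hence is the zero polynomial.\<close>
  define P where "P = (\<Sum>t\<in>T. smult (c t) (Q t))"
  have "poly P x = 0" if x: "x \<in> X" for x
  proof -
    have "poly P x = (\<Sum>t\<in>T. poly D x * (c t / (x + of_rat (snd t)) ^ fst t))"
      unfolding P_def poly_sum
    proof (rule sum.cong)
      fix t assume t: "t \<in> T"
      obtain j m where jm: "t = (j, m)"
        by force
      have "x + of_rat m \<noteq> 0"
        using nonpole[OF x, of j m] t jm by (simp add: T_def)
      then show "poly (smult (c t) (Q t)) x = poly D x * (c t / (x + of_rat (snd t)) ^ fst t)"
        using D[of j m] t jm by (simp add: poly_l)
    qed simp
    also have "\<dots> = poly D x * (\<Sum>t\<in>S. c t / (x + of_rat (snd t)) ^ fst t)"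
      unfolding sum_distrib_left[symmetric]
      by (rule arg_cong[where f = "(*) _"], rule sum.mono_neutral_left)
        (use fin in \<open>auto simp: T_def\<close>)
    finally show ?thesis
      using zero[OF x] by simp
  qed
  then have "X \<subseteq> {x. poly P x = 0}"
    by auto
  then have "P = 0"
    using inf poly_roots_finite[of P] finite_subset by blast
  \<comment> \<open>A factor \<open>l m0\<close> is left in every other term: lower powers at
    \<open>m0\<close> keep \<open>k - j > 0\<close> of them, the other nodes keep
    \<open>k > 0\<close>.\<close>
  have vanish: "poly (smult (c t) (Q t)) (- of_rat m0) = 0" if t: "t \<in> T - {(k, m0)}" for t
  proof (cases t)
    case (Pair j m)
    show ?thesis
    proof (cases "m = m0")
      case True
      then have "j < k"
        using k_max[of j] t Pair by (cases "j = k") auto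
      then show ?thesis
        using Pair True by (simp add: Q_def poly_l)
    next
      case False
      have "k \<noteq> 0"
        using pos[of k m0] k by (auto simp: T_def)
      then show ?thesis
        using Pair False by (simp add: Q_def poly_l)
    qed
  qed
  have "(\<Sum>t\<in>T - {(k, m0)}. poly (smult (c t) (Q t)) (- of_rat m0)) = 0"
    by (rule sum.neutral) (use vanish in blast)
  then have "poly P (- of_rat m0) = c (k, m0) * poly (Q (k, m0)) (- of_rat m0)"
    unfolding P_def poly_sum by (subst sum.remove[OF finT k]) simp
  moreover have "poly (Q (k, m0)) (- of_rat m0) \<noteq> 0"
    using finM by (auto simp: Q_def poly_prod poly_l M_def)
  moreover have "c (k, m0) \<noteq> 0"
    using k by (simp add: T_def)
  ultimately show False
    using \<open>P = 0\<close> by simp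
qed

text \<open>The difference of two decompositions is a vanishing combination of inverse powers at
  distinct nodes; outside the summation ranges all coefficients are 0 by convention.\<close>

lemma is_partial_fraction_unique:
  assumes "m1 \<noteq> m2" and pf: "is_partial_fraction k1 m1 k2 m2 a b"
    and pf': "is_partial_fraction k1 m1 k2 m2 a' b'"
  shows "a = a' \<and> b = b'"
proof -
  define c where "c = (\<lambda>(i, m). if m = m1 then a i - a' i else b i - b' i)"
  define S where "S = (\<lambda>i. (i, m1)) ` {1..k1} \<union> (\<lambda>i. (i, m2)) ` {1..k2}"
  have c0: "c s = 0" if "s \<in> S" for s
  proof (rule inverse_powers_independent[of S "UNIV - {- m1, - m2}" c])
    show "infinite (UNIV - {- m1, - m2})"
      by (simp add: infinite_UNIV_char_0)
  next
    fix x assume x: "x \<in> UNIV - {- m1, - m2}"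
    have "(\<Sum>s\<in>S. c s / (x + snd s) ^ fst s) =
        (\<Sum>i=1..k1. (a i - a' i) / (x + m1) ^ i) + (\<Sum>j=1..k2. (b j - b' j) / (x + m2) ^ j)"
      unfolding S_def using \<open>m1 \<noteq> m2\<close>
      by (subst sum.union_disjoint)
        (auto simp: sum.reindex inj_on_def c_def)
    also have "\<dots> = 0"
    proof -
      have "(\<Sum>i=1..k1. a i / (x + m1) ^ i) + (\<Sum>j=1..k2. b j / (x + m2) ^ j) =
          (\<Sum>i=1..k1. a' i / (x + m1) ^ i) + (\<Sum>j=1..k2. b' j / (x + m2) ^ j)"
        using pf pf' x by (simp add: is_partial_fraction_def)
      then show ?thesis
        by (simp add: diff_divide_distrib sum_subtractf algebra_simps)
    qed
    finally show "(\<Sum>s\<in>S. c s / (x + of_rat (snd s)) ^ fst s) = 0"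
      by simp
  qed (use that in \<open>auto simp: S_def add_eq_0_iff2\<close>)
  have "a i = a' i" for i
  proof (cases "i \<in> {1..k1}")
    case True
    then show ?thesis
      using c0[of "(i, m1)"] by (simp add: c_def S_def)
  qed (use pf pf' in \<open>auto simp: is_partial_fraction_def\<close>)
  moreover have "b i = b' i" for i
  proof (cases "i \<in> {1..k2}")
    case True
    then show ?thesis
      using c0[of "(i, m2)"] \<open>m1 \<noteq> m2\<close> by (simp add: c_def S_def)
  qed (use pf pf' in \<open>auto simp: is_partial_fraction_def\<close>)
  ultimately show ?thesis
    by auto
qed

lemma is_partial_fraction_exists:
  assumes "m1 \<noteq> m2" "0 < k1 + k2"
  shows "\<exists>a b. is_partial_fraction k1 m1 k2 m2 a b"
  using assms(2)
proof (induction "k1 + k2" arbitrary: k1 k2 rule: less_induct)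
  case less
  consider "k1 = 0" "k2 > 0" | "k2 = 0" "k1 > 0" | "k1 > 0" "k2 > 0"
    using less.prems by auto
  then show ?case
  proof cases
    case 1
    then have "is_partial_fraction k1 m1 k2 m2 (\<lambda>_. 0) (\<lambda>j. if j = k2 then 1 else 0)"
      by (auto simp: is_partial_fraction_def if_distrib[where f = "\<lambda>z. z / _"] cong: if_cong)
    then show ?thesis
      by blast
  next
    case 2
    then have "is_partial_fraction k1 m1 k2 m2 (\<lambda>j. if j = k1 then 1 else 0) (\<lambda>_. 0)"
      by (auto simp: is_partial_fraction_def if_distrib[where f = "\<lambda>z. z / _"] cong: if_cong)
    then show ?thesis
      by blast
  next
    case 3
    then obtain p q where pq: "k1 = Suc p" "k2 = Suc q"
      by (metis gr0_implies_Suc)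
    obtain a b where ab: "is_partial_fraction k1 m1 q m2 a b"
      using less.hyps[of k1 q] pq by auto
    obtain a' b' where ab': "is_partial_fraction p m1 k2 m2 a' b'"
      using less.hyps[of p k2] pq by auto
    define d where "d = m2 - m1"
    have "d \<noteq> 0"
      using assms(1) by (simp add: d_def)
    have "1 / ((x + m1) ^ k1 * (x + m2) ^ k2) =
        (\<Sum>i=1..k1. ((a i - a' i) / d) / (x + m1) ^ i) +
        (\<Sum>j=1..k2. ((b j - b' j) / d) / (x + m2) ^ j)"
      if x: "x \<noteq> - m1" "x \<noteq> - m2" for x
    proof -
      have ne: "x + m1 \<noteq> 0" "x + m2 \<noteq> 0"
        using x by (simp_all add: add_eq_0_iff2)
      have d: "d = (x + m2) - (x + m1)"
        by (simp add: d_def)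
      have "1 / ((x + m1) ^ k1 * (x + m2) ^ k2) =
          (1 / ((x + m1) ^ k1 * (x + m2) ^ q) - 1 / ((x + m1) ^ p * (x + m2) ^ k2)) / d"
        using ne \<open>d \<noteq> 0\<close> unfolding pq
        by (simp add: divide_simps) (simp add: d algebra_simps)
      also have "1 / ((x + m1) ^ k1 * (x + m2) ^ q) =
          (\<Sum>i=1..k1. a i / (x + m1) ^ i) + (\<Sum>j=1..k2. b j / (x + m2) ^ j)"
        using ab x pq by (simp add: is_partial_fraction_def)
      also have "1 / ((x + m1) ^ p * (x + m2) ^ k2) =
          (\<Sum>i=1..k1. a' i / (x + m1) ^ i) + (\<Sum>j=1..k2. b' j / (x + m2) ^ j)"
        using ab' x pq by (simp add: is_partial_fraction_def)
      finally show ?thesis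
        by (simp add: sum_divide_distrib add_divide_distrib diff_divide_distrib sum_subtractf
            mult.commute)
    qed
    \<comment> \<open>Since \<open>p < k1\<close> and \<open>q < k2\<close>, the coefficients of
      both smaller decompositions also vanish outside the larger ranges.\<close>
    then have "is_partial_fraction k1 m1 k2 m2 (\<lambda>i. (a i - a' i) / d) (\<lambda>j. (b j - b' j) / d)"
      using ab ab' pq by (auto simp: is_partial_fraction_def)
    then show ?thesis
      by blast
  qed
qed

text \<open>Existence and uniqueness together make the \<open>THE\<close> in
  \<open>partial_fraction\<close> denote an actual decomposition.\<close>

lemma partial_fraction_correct:
  assumes "m1 \<noteq> m2" "0 < k1 + k2" "partial_fraction k1 m1 k2 m2 = (a, b)"
  shows "is_partial_fraction k1 m1 k2 m2 a b"
proof -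
  obtain a0 b0 where ab0: "is_partial_fraction k1 m1 k2 m2 a0 b0"
    using is_partial_fraction_exists[OF assms(1,2)] by blast
  have "partial_fraction k1 m1 k2 m2 = (a0, b0)"
    unfolding partial_fraction_def
  proof (rule the_equality)
    fix y assume "case y of (a, b) \<Rightarrow> is_partial_fraction k1 m1 k2 m2 a b"
    then show "y = (a0, b0)"
      using is_partial_fraction_unique[OF assms(1) _ ab0] by (cases y) blast
  qed (simp add: ab0)
  with assms(3) ab0 show ?thesis
    by simp
qed

section \<open>The product of letters\<close>

definition letter_span :: "(word \<Rightarrow>\<^sub>0 complex) set" where
  "letter_span = {p. Poly_Mapping.keys p \<subseteq> (\<lambda>y. [y]) ` Y}"

lemma letter_span_word_elem: "y \<in> Y \<Longrightarrow> word_elem [y] \<in> letter_span"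
  by (simp add: letter_span_def word_elem_def)

lemma letter_span_scale: "p \<in> letter_span \<Longrightarrow> scale c p \<in> letter_span"
  using keys_scale_subset[of c p] by (auto simp: letter_span_def)

lemma letter_span_add: "p \<in> letter_span \<Longrightarrow> q \<in> letter_span \<Longrightarrow> p + q \<in> letter_span"
  using keys_add[of p q] by (auto simp: letter_span_def)

lemma letter_span_sum:
  "(\<And>a. a \<in> A \<Longrightarrow> f a \<in> letter_span) \<Longrightarrow> sum f A \<in> letter_span"
  by (induction A rule: infinite_finite_induct)
    (auto simp: letter_span_add, simp_all add: letter_span_def)

lemma letter_prod_in_letter_span:
  assumes "x \<in> Y" "y \<in> Y"
  shows "letter_prod x y \<in> letter_span"
proof (cases x, cases y)
  fix k1 m1 k2 m2 assume "x = (k1, m1)" "y = (k2, m2)"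
  then show ?thesis
    using assms
    by (auto simp: Y_def split: prod.split
        intro!: letter_span_word_elem letter_span_add letter_span_sum letter_span_scale)
qed

text \<open>The value at \<open>x\<close> of the rational function attached to a combination of
  letters. \<open>hd\<close> reads off the letter of a one-letter word, so this is meaningful only
  on \<open>letter_span\<close>.\<close>

definition letter_eval :: "rat \<Rightarrow> (word \<Rightarrow>\<^sub>0 complex) \<Rightarrow> complex" where
  "letter_eval x = linear_functional (\<lambda>w. 1 / of_rat (x + snd (hd w)) ^ fst (hd w))"

text \<open>Linear independence of the inverse powers. Positive points suffice: there are infinitely
  many, and they avoid the poles because \<open>m > 0\<close> for letters in
  \<open>Y\<close>.\<close>

lemma letter_eval_inject:
  assumes "p \<in> letter_span" "q \<in> letter_span"
    and eval: "\<And>x. 0 < x \<Longrightarrow> letter_eval x p = letter_eval x q"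
  shows "p = q"
proof -
  \<comment> \<open>The difference \<open>p - q\<close>, in a form to which the closure lemmas of
    \<open>letter_span\<close> apply.\<close>
  define d where "d = p + scale (- 1) q"
  have "d \<in> letter_span"
    using assms by (simp add: d_def letter_span_add letter_span_scale)
  then have keys: "Poly_Mapping.keys d \<subseteq> (\<lambda>y. [y]) ` Y"
    by (simp add: letter_span_def)
  define S where "S = {y. [y] \<in> Poly_Mapping.keys d}"
  have keys_eq: "Poly_Mapping.keys d = (\<lambda>y. [y]) ` S" and SY: "S \<subseteq> Y"
    using keys by (auto simp: S_def)
  have "finite S"
    using finite_imageD[of "\<lambda>y. [y]" S] keys_eq finite_keys[of d] by (simp add: inj_on_def)
  have "Poly_Mapping.lookup d [s] = 0" if "s \<in> S" for s
  proof (rule inverse_powers_independent[of S "of_rat ` {0<..}" "\<lambda>s. Poly_Mapping.lookup d [s]"])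
    show "infinite (of_rat ` {0<..} :: complex set)"
      using finite_imageD[of "of_rat :: rat \<Rightarrow> complex" "{0<..}"] infinite_Ioi[of "0 :: rat"]
      by (auto simp: inj_on_def)
  next
    fix z :: complex assume "z \<in> of_rat ` {0<..}"
    then obtain x where x: "z = of_rat x" "0 < x"
      by auto
    have "(\<Sum>s\<in>S. Poly_Mapping.lookup d [s] / (z + of_rat (snd s)) ^ fst s) = letter_eval x d"
      unfolding letter_eval_def linear_functional_def keys_eq
      by (simp add: sum.reindex inj_on_def x of_rat_add)
    also have "\<dots> = 0"
      using eval[OF x(2)]
      by (simp add: d_def letter_eval_def linear_functional_add linear_functional_scale)
    finally show "(\<Sum>s\<in>S. Poly_Mapping.lookup d [s] / (z + of_rat (snd s)) ^ fst s) = 0" .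
  next
    fix z :: complex and k m assume "z \<in> of_rat ` {0<..}" "(k, m) \<in> S"
    then obtain x where x: "z = of_rat x" "0 < x" "0 < m"
      using SY by (auto simp: Y_def)
    then have "of_rat (x + m) \<noteq> (0 :: complex)"
      by simp
    then show "z + of_rat m \<noteq> 0"
      by (simp add: x of_rat_add)
  qed (use SY that \<open>finite S\<close> in \<open>auto simp: Y_def\<close>)
  then have "S = {}"
    by (auto simp: S_def in_keys_iff)
  then have "d = 0"
    using keys_eq by simp
  moreover have "p - q = d"
    by (rule poly_mapping_eqI) (simp add: d_def lookup_add lookup_minus)
  ultimately show ?thesis
    by simp
qed

text \<open>For equal nodes the exponents add; for distinct ones the partial fraction identity is
  evaluated at \<open>x\<close>, which is not a pole.\<close>

lemma letter_eval_letter_prod: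
  assumes "y \<in> Y" "z \<in> Y" "0 < x"
  shows "letter_eval x (letter_prod y z) = letter_eval x (word_elem [y]) * letter_eval x (word_elem [z])"
proof (cases y, cases z)
  fix k1 m1 k2 m2 assume yz: "y = (k1, m1)" "z = (k2, m2)"
  show ?thesis
  proof (cases "m1 = m2")
    case True
    then show ?thesis
      by (simp add: yz letter_eval_def power_add)
  next
    case False
    obtain a b where ab: "partial_fraction k1 m1 k2 m2 = (a, b)"
      by force
    have "0 < k1 + k2"
      using assms yz by (simp add: Y_def)
    from partial_fraction_correct[OF False this ab]
    have "1 / ((x + m1) ^ k1 * (x + m2) ^ k2) =
        (\<Sum>i=1..k1. a i / (x + m1) ^ i) + (\<Sum>j=1..k2. b j / (x + m2) ^ j)"
      using assms yz by (simp add: is_partial_fraction_def Y_def)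
    from arg_cong[OF this, of "of_rat :: rat \<Rightarrow> complex"] show ?thesis
      using False
      by (simp add: yz ab letter_eval_def linear_functional_add linear_functional_sum
          linear_functional_scale of_rat_add of_rat_sum of_rat_divide of_rat_mult of_rat_power)
  qed
qed

text \<open>Iterated products need this extension: \<open>letter_prod\<close> accepts only letters,
  while its value is already a combination of letters.\<close>

definition letter_mult :: "(word \<Rightarrow>\<^sub>0 complex) \<Rightarrow> (word \<Rightarrow>\<^sub>0 complex) \<Rightarrow> (word \<Rightarrow>\<^sub>0 complex)" where
  "letter_mult = bilinear_ext (\<lambda>u v. letter_prod (hd u) (hd v))"

lemma letter_mult_word_elem [simp]:
  "letter_mult (word_elem [x]) (word_elem [y]) = letter_prod x y"
  by (simp add: letter_mult_def)

lemma letter_mult_in_letter_span: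
  assumes "p \<in> letter_span" "q \<in> letter_span"
  shows "letter_mult p q \<in> letter_span"
  unfolding letter_mult_def bilinear_ext_def
  by (intro letter_span_sum letter_span_scale letter_prod_in_letter_span)
    (use assms in \<open>auto simp: letter_span_def\<close>)

lemma letter_eval_letter_mult:
  assumes "p \<in> letter_span" "q \<in> letter_span" "0 < x"
  shows "letter_eval x (letter_mult p q) = letter_eval x p * letter_eval x q"
proof -
  let ?\<phi> = "\<lambda>w. letter_eval x (word_elem w)"
  have eval: "letter_eval x r = (\<Sum>u\<in>Poly_Mapping.keys r. Poly_Mapping.lookup r u * ?\<phi> u)" for r
    by (simp add: letter_eval_def linear_functional_def[of _ r])
  have "letter_eval x (letter_mult p q) = (\<Sum>u\<in>Poly_Mapping.keys p. \<Sum>v\<in>Poly_Mapping.keys q.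
      Poly_Mapping.lookup p u * Poly_Mapping.lookup q v * letter_eval x (letter_prod (hd u) (hd v)))"
    by (simp add: letter_mult_def bilinear_ext_def letter_eval_def linear_functional_sum
        linear_functional_scale)
  also have "\<dots> = (\<Sum>u\<in>Poly_Mapping.keys p. \<Sum>v\<in>Poly_Mapping.keys q.
      (Poly_Mapping.lookup p u * ?\<phi> u) * (Poly_Mapping.lookup q v * ?\<phi> v))"
  proof (intro sum.cong refl)
    fix u v assume "u \<in> Poly_Mapping.keys p" "v \<in> Poly_Mapping.keys q"
    then obtain y z where "u = [y]" "y \<in> Y" "v = [z]" "z \<in> Y"
      using assms(1,2) unfolding letter_span_def by blast
    then show "Poly_Mapping.lookup p u * Poly_Mapping.lookup q v *
        letter_eval x (letter_prod (hd u) (hd v)) =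
        (Poly_Mapping.lookup p u * ?\<phi> u) * (Poly_Mapping.lookup q v * ?\<phi> v)"
      using letter_eval_letter_prod[of y z x] assms by simp
  qed
  also have "\<dots> = letter_eval x p * letter_eval x q"
    by (simp add: eval[of p] eval[of q] sum_product)
  finally show ?thesis .
qed

lemma letter_prod_commute:
  assumes "x \<in> Y" "y \<in> Y"
  shows "letter_prod x y = letter_prod y x"
  by (rule letter_eval_inject)
    (use assms in \<open>simp_all add: letter_prod_in_letter_span letter_eval_letter_prod\<close>)

text \<open>Evaluation turns both sides into the same product of three complex numbers, so no
  partial fraction coefficients have to be compared.\<close>

lemma letter_mult_assoc:
  assumes "p \<in> letter_span" "q \<in> letter_span" "r \<in> letter_span"
  shows "letter_mult (letter_mult p q) r = letter_mult p (letter_mult q r)"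
  by (rule letter_eval_inject)
    (use assms in \<open>simp_all add: letter_mult_in_letter_span letter_eval_letter_mult\<close>)

section \<open>The stuffle product\<close>

lemma stuffle_word_Nil_right [simp]: "stuffle_word \<mu> u [] = word_elem u"
  by (cases u rule: rev_cases) simp_all

lemma stuffle_word_elem [simp]: "stuffle \<mu> (word_elem u) (word_elem v) = stuffle_word \<mu> u v"
  by (simp add: stuffle_def)

lemma conc_word_elem [simp]: "conc (word_elem u) (word_elem v) = word_elem (u @ v)"
  by (simp add: conc_def)

lemmas product_defs = stuffle_def conc_def letter_mult_def

lemma lin_product_intros:
  "lin f \<Longrightarrow> lin (\<lambda>p. stuffle \<mu> (f p) q)"
  "lin f \<Longrightarrow> lin (\<lambda>p. stuffle \<mu> q (f p))"
  "lin f \<Longrightarrow> lin (\<lambda>p. conc (f p) q)"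
  "lin f \<Longrightarrow> lin (\<lambda>p. conc q (f p))"
  "lin f \<Longrightarrow> lin (\<lambda>p. letter_mult (f p) q)"
  "lin f \<Longrightarrow> lin (\<lambda>p. letter_mult q (f p))"
  unfolding product_defs by (rule lin_intros, assumption)+

lemmas stuffle_linear = bilinear_ext_simps[where f = "stuffle_word \<mu>" for \<mu>, folded stuffle_def]
lemmas conc_linear =
  bilinear_ext_simps[where f = "\<lambda>u v. word_elem (u @ v)", folded conc_def]

text \<open>In the proof of associativity the last factor can be a combination such as
  \<open>letter_mult X Y'\<close>, to which the recursion on words does not apply directly. Both
  sides are linear in \<open>p\<close>, \<open>q\<close>, \<open>a\<close> and \<open>b\<close>,
  which reduces the claim to that recursion.\<close>

lemma stuffle_rec:
  assumes "a \<in> letter_span" "b \<in> letter_span"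
  shows "stuffle \<mu> (conc p a) (conc q b) =
     conc (stuffle \<mu> p (conc q b)) a + conc (stuffle \<mu> (conc p a) q) b -
     scale \<mu> (conc (stuffle \<mu> p q) (letter_mult a b))"
proof (rule lin_eqI[where p = p]; (intro lin_intros lin_product_intros)?)
  fix u
  show "stuffle \<mu> (conc (word_elem u) a) (conc q b) =
     conc (stuffle \<mu> (word_elem u) (conc q b)) a + conc (stuffle \<mu> (conc (word_elem u) a) q) b -
     scale \<mu> (conc (stuffle \<mu> (word_elem u) q) (letter_mult a b))"
  proof (rule lin_eqI[where p = q]; (intro lin_intros lin_product_intros)?)
    fix v
    show "stuffle \<mu> (conc (word_elem u) a) (conc (word_elem v) b) =
       conc (stuffle \<mu> (word_elem u) (conc (word_elem v) b)) a +
       conc (stuffle \<mu> (conc (word_elem u) a) (word_elem v)) b -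
       scale \<mu> (conc (stuffle \<mu> (word_elem u) (word_elem v)) (letter_mult a b))"
    proof (rule lin_eqI[where p = a]; (intro lin_intros lin_product_intros)?)
      fix s assume "s \<in> Poly_Mapping.keys a"
      then obtain x where s: "s = [x]"
        using assms by (auto simp: letter_span_def)
      show "stuffle \<mu> (conc (word_elem u) (word_elem s)) (conc (word_elem v) b) =
         conc (stuffle \<mu> (word_elem u) (conc (word_elem v) b)) (word_elem s) +
         conc (stuffle \<mu> (conc (word_elem u) (word_elem s)) (word_elem v)) b -
         scale \<mu> (conc (stuffle \<mu> (word_elem u) (word_elem v)) (letter_mult (word_elem s) b))"
      proof (rule lin_eqI[where p = b]; (intro lin_intros lin_product_intros)?)
        fix t assume "t \<in> Poly_Mapping.keys b"
        then obtain y where t: "t = [y]"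
          using assms by (auto simp: letter_span_def)
        show "stuffle \<mu> (conc (word_elem u) (word_elem s)) (conc (word_elem v) (word_elem t)) =
           conc (stuffle \<mu> (word_elem u) (conc (word_elem v) (word_elem t))) (word_elem s) +
           conc (stuffle \<mu> (conc (word_elem u) (word_elem s)) (word_elem v)) (word_elem t) -
           scale \<mu> (conc (stuffle \<mu> (word_elem u) (word_elem v))
             (letter_mult (word_elem s) (word_elem t)))"
          by (simp add: s t)
      qed
    qed
  qed
qed

text \<open>Swapping the arguments exchanges the first two terms of the recursion; the third is
  symmetric by induction and commutativity of the letter product.\<close>

lemma stuffle_word_commute:
  assumes "u \<in> lists Y" "v \<in> lists Y"
  shows "stuffle_word \<mu> u v = stuffle_word \<mu> v u"
  using assms
proof (induction \<mu> u v rule: stuffle_word.induct)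
  case (3 \<mu> u x v y)
  then show ?case
    using letter_prod_commute[of x y] by (simp add: algebra_simps)
qed simp_all

lemma stuffle_Nil_left [simp]: "stuffle \<mu> (word_elem []) p = p"
  by (rule lin_eqI[where p = p]; (intro lin_intros lin_product_intros)?) simp

lemma stuffle_Nil_right [simp]: "stuffle \<mu> p (word_elem []) = p"
  by (rule lin_eqI[where p = p]; (intro lin_intros lin_product_intros)?) simp

lemma stuffle_word_assoc:
  assumes "u \<in> lists Y" "v \<in> lists Y" "w \<in> lists Y"
  shows "stuffle \<mu> (stuffle_word \<mu> u v) (word_elem w) = stuffle \<mu> (word_elem u) (stuffle_word \<mu> v w)"
  using assms
proof (induction "length u + length v + length w" arbitrary: u v w rule: less_induct)
  case less
  show ?case
  proof (cases "u = [] \<or> v = [] \<or> w = []")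
    case True
    then show ?thesis
      by auto
  next
    case False
    then obtain u' x v' y w' z where uvw: "u = u' @ [x]" "v = v' @ [y]" "w = w' @ [z]"
      by (metis rev_exhaust)
    have Y: "u' \<in> lists Y" "v' \<in> lists Y" "w' \<in> lists Y" "x \<in> Y" "y \<in> Y" "z \<in> Y"
      using less.prems uvw by auto
    define U V W U' V' W' X Y' Z where defs: "U = word_elem u" "V = word_elem v" "W = word_elem w"
      "U' = word_elem u'" "V' = word_elem v'" "W' = word_elem w'"
      "X = word_elem [x]" "Y' = word_elem [y]" "Z = word_elem [z]"
    have UVW: "U = conc U' X" "V = conc V' Y'" "W = conc W' Z"
      by (simp_all add: defs uvw)
    have XYZ: "X \<in> letter_span" "Y' \<in> letter_span" "Z \<in> letter_span"
      using Y by (simp_all add: defs letter_span_word_elem)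
    note span = letter_mult_in_letter_span[OF XYZ(1,2)] letter_mult_in_letter_span[OF XYZ(2,3)]
    let ?S = "stuffle \<mu>"
    \<comment> \<open>One instance for each nonempty set of factors that lose their last
      letter.\<close>
    have IH: "?S (?S U' V) W = ?S U' (?S V W)" "?S (?S U V') W = ?S U (?S V' W)"
      "?S (?S U V) W' = ?S U (?S V W')" "?S (?S U' V') W = ?S U' (?S V' W)"
      "?S (?S U' V) W' = ?S U' (?S V W')" "?S (?S U V') W' = ?S U (?S V' W')"
      "?S (?S U' V') W' = ?S U' (?S V' W')"
      unfolding defs stuffle_word_elem by (rule less.hyps; use Y uvw in simp)+
    have UV: "?S U V = conc (?S U' V) X + conc (?S U V') Y' -
        scale \<mu> (conc (?S U' V') (letter_mult X Y'))"
      unfolding UVW by (rule stuffle_rec[OF XYZ(1,2)])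
    have VW: "?S V W = conc (?S V' W) Y' + conc (?S V W') Z -
        scale \<mu> (conc (?S V' W') (letter_mult Y' Z))"
      unfolding UVW by (rule stuffle_rec[OF XYZ(2,3)])
    \<comment> \<open>Stated for general \<open>a\<close> because it is applied to \<open>X\<close>,
      to \<open>Y'\<close> and to the combination \<open>letter_mult X Y'\<close>.\<close>
    have left: "?S (conc p a) W = conc (?S p W) a + conc (?S (conc p a) W') Z -
        scale \<mu> (conc (?S p W') (letter_mult a Z))" if "a \<in> letter_span" for p a
      unfolding UVW by (rule stuffle_rec[OF that XYZ(3)])
    have right: "?S U (conc p a) = conc (?S U' (conc p a)) X + conc (?S U p) a -
        scale \<mu> (conc (?S U' p) (letter_mult X a))" if "a \<in> letter_span" for p a
      unfolding UVW by (rule stuffle_rec[OF XYZ(1) that])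
    \<comment> \<open>The terms ending in \<open>Z\<close> that come from the three summands of
      \<open>?S U V\<close> recombine by linearity into the product of \<open>?S U V\<close> with
      \<open>W'\<close>.\<close>
    have "?S (?S U V) W =
        conc (?S (?S U' V) W) X + conc (?S (?S U V') W) Y' + conc (?S (?S U V) W') Z
        - scale \<mu> (conc (?S (?S U' V) W') (letter_mult X Z))
        - scale \<mu> (conc (?S (?S U V') W') (letter_mult Y' Z))
        - scale \<mu> (conc (?S (?S U' V') W) (letter_mult X Y'))
        + scale (\<mu> * \<mu>) (conc (?S (?S U' V') W') (letter_mult (letter_mult X Y') Z))"
      unfolding UV
      by (simp add: stuffle_linear conc_linear left XYZ span scale_add_right scale_diff_right
          algebra_simps)
    \<comment> \<open>Here the terms ending in \<open>X\<close> recombine, into the product of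
      \<open>U'\<close> with \<open>?S V W\<close>.\<close>
    moreover have "?S U (?S V W) =
        conc (?S U' (?S V W)) X + conc (?S U (?S V' W)) Y' + conc (?S U (?S V W')) Z
        - scale \<mu> (conc (?S U' (?S V W')) (letter_mult X Z))
        - scale \<mu> (conc (?S U (?S V' W')) (letter_mult Y' Z))
        - scale \<mu> (conc (?S U' (?S V' W)) (letter_mult X Y'))
        + scale (\<mu> * \<mu>) (conc (?S U' (?S V' W')) (letter_mult X (letter_mult Y' Z)))"
      unfolding VW
      by (simp add: stuffle_linear conc_linear right XYZ span scale_add_right scale_diff_right
          algebra_simps)
    \<comment> \<open>The induction hypotheses match the terms pairwise; associativity of the letter
      product enters only in the term with \<open>\<mu> * \<mu>\<close>.\<close>
    ultimately have "?S (?S U V) W = ?S U (?S V W)"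
      unfolding IH letter_mult_assoc[OF XYZ] by simp
    then show ?thesis
      by (simp add: defs)
  qed
qed

section \<open>Extension of the identities from words to linear combinations\<close>

lemma stuffle_commute:
  assumes "Poly_Mapping.keys p \<subseteq> lists Y" "Poly_Mapping.keys q \<subseteq> lists Y"
  shows "stuffle \<mu> p q = stuffle \<mu> q p"
proof (rule lin_eqI[where p = p]; (intro lin_intros lin_product_intros)?)
  fix u assume u: "u \<in> Poly_Mapping.keys p"
  show "stuffle \<mu> (word_elem u) q = stuffle \<mu> q (word_elem u)"
    by (rule lin_eqI[where p = q]; (intro lin_intros lin_product_intros)?)
      (use assms u stuffle_word_commute in \<open>simp add: subset_iff\<close>)
qed

lemma stuffle_assoc:
  assumes "Poly_Mapping.keys p \<subseteq> lists Y" "Poly_Mapping.keys q \<subseteq> lists Y"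
    "Poly_Mapping.keys r \<subseteq> lists Y"
  shows "stuffle \<mu> (stuffle \<mu> p q) r = stuffle \<mu> p (stuffle \<mu> q r)"
proof (rule lin_eqI[where p = p]; (intro lin_intros lin_product_intros)?)
  fix u assume u: "u \<in> Poly_Mapping.keys p"
  show "stuffle \<mu> (stuffle \<mu> (word_elem u) q) r = stuffle \<mu> (word_elem u) (stuffle \<mu> q r)"
  proof (rule lin_eqI[where p = q]; (intro lin_intros lin_product_intros)?)
    fix v assume v: "v \<in> Poly_Mapping.keys q"
    show "stuffle \<mu> (stuffle \<mu> (word_elem u) (word_elem v)) r =
        stuffle \<mu> (word_elem u) (stuffle \<mu> (word_elem v) r)"
    proof (rule lin_eqI[where p = r]; (intro lin_intros lin_product_intros)?)
      fix w assume w: "w \<in> Poly_Mapping.keys r"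
      show "stuffle \<mu> (stuffle \<mu> (word_elem u) (word_elem v)) (word_elem w) =
          stuffle \<mu> (word_elem u) (stuffle \<mu> (word_elem v) (word_elem w))"
        unfolding stuffle_word_elem by (rule stuffle_word_assoc) (use assms u v w in blast)+
    qed
  qed
qed

section \<open>The coefficient ring and the free module\<close>

lemma Qmu_I: "(\<And>i. coeff p i \<in> \<rat>) \<Longrightarrow> poly p \<mu> \<in> Qmu \<mu>"
  unfolding Qmu_def by blast

lemma Qmu_E:
  assumes "a \<in> Qmu \<mu>"
  obtains p where "a = poly p \<mu>" "\<And>i. coeff p i \<in> \<rat>"
  using assms unfolding Qmu_def by blast

lemma Qmu_Rats: "a \<in> \<rat> \<Longrightarrow> a \<in> Qmu \<mu>"
  using Qmu_I[of "[:a:]" \<mu>] by (simp add: coeff_pCons split: nat.split)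

lemma Qmu_generator: "\<mu> \<in> Qmu \<mu>"
  using Qmu_I[of "[:0, 1:]" \<mu>] by (simp add: coeff_pCons split: nat.split)

lemma Qmu_add:
  assumes "a \<in> Qmu \<mu>" "b \<in> Qmu \<mu>"
  shows "a + b \<in> Qmu \<mu>"
proof -
  obtain p q where "a = poly p \<mu>" "\<And>i. coeff p i \<in> \<rat>" "b = poly q \<mu>" "\<And>i. coeff q i \<in> \<rat>"
    using assms by (metis Qmu_E)
  then show ?thesis
    using Qmu_I[of "p + q" \<mu>] by simp
qed

lemma Qmu_mult:
  assumes "a \<in> Qmu \<mu>" "b \<in> Qmu \<mu>"
  shows "a * b \<in> Qmu \<mu>"
proof -
  obtain p q where "a = poly p \<mu>" "\<And>i. coeff p i \<in> \<rat>" "b = poly q \<mu>" "\<And>i. coeff q i \<in> \<rat>"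
    using assms by (metis Qmu_E)
  then show ?thesis
    using Qmu_I[of "p * q" \<mu>] by (simp add: coeff_mult Rats_sum)
qed

lemma Qmu_uminus: "a \<in> Qmu \<mu> \<Longrightarrow> - a \<in> Qmu \<mu>"
  using Qmu_mult[of "- 1" \<mu> a] by (simp add: Qmu_Rats)

lemma cring_Qmu_ring: "cring (Qmu_ring \<mu>)"
proof (rule cringI)
  show "abelian_group (Qmu_ring \<mu>)"
  proof (rule abelian_groupI)
    fix a assume "a \<in> carrier (Qmu_ring \<mu>)"
    then show "\<exists>b\<in>carrier (Qmu_ring \<mu>). b \<oplus>\<^bsub>Qmu_ring \<mu>\<^esub> a = \<zero>\<^bsub>Qmu_ring \<mu>\<^esub>"
      using Qmu_uminus[of a \<mu>] by (intro bexI[of _ "- a"]) (simp_all add: Qmu_ring_def)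
  qed (simp_all add: Qmu_ring_def Qmu_add Qmu_Rats)
  show "Group.comm_monoid (Qmu_ring \<mu>)"
    by (rule comm_monoidI) (simp_all add: Qmu_ring_def Qmu_mult Qmu_Rats)
qed (simp add: Qmu_ring_def algebra_simps)

section \<open>Closure of the free module under the operations\<close>

lemma QmuY_word_elem: "w \<in> lists Y \<Longrightarrow> word_elem w \<in> QmuY \<mu>"
  by (simp add: QmuY_def word_elem_def lookup_single when_def Qmu_Rats)

lemma QmuY_add: "p \<in> QmuY \<mu> \<Longrightarrow> q \<in> QmuY \<mu> \<Longrightarrow> p + q \<in> QmuY \<mu>"
  using keys_add[of p q] by (simp add: QmuY_def lookup_add Qmu_add) blast

lemma QmuY_scale: "a \<in> Qmu \<mu> \<Longrightarrow> p \<in> QmuY \<mu> \<Longrightarrow> scale a p \<in> QmuY \<mu>"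
  using keys_scale_subset[of a p] by (auto simp: QmuY_def Qmu_mult)

lemma QmuY_zero: "0 \<in> QmuY \<mu>"
  by (simp add: QmuY_def Qmu_Rats)

lemma QmuY_uminus: "p \<in> QmuY \<mu> \<Longrightarrow> - p \<in> QmuY \<mu>"
  by (simp add: QmuY_def Qmu_uminus)

lemma QmuY_diff: "p \<in> QmuY \<mu> \<Longrightarrow> q \<in> QmuY \<mu> \<Longrightarrow> p - q \<in> QmuY \<mu>"
  using QmuY_add[of p \<mu> "- q"] by (simp add: QmuY_uminus)

lemma QmuY_sum: "(\<And>a. a \<in> A \<Longrightarrow> f a \<in> QmuY \<mu>) \<Longrightarrow> sum f A \<in> QmuY \<mu>"
  by (induction A rule: infinite_finite_induct) (simp_all add: QmuY_zero QmuY_add)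

lemma QmuY_bilinear_ext:
  assumes "p \<in> QmuY \<mu>" "q \<in> QmuY \<mu>"
    and "\<And>u v. u \<in> lists Y \<Longrightarrow> v \<in> lists Y \<Longrightarrow> f u v \<in> QmuY \<mu>"
  shows "bilinear_ext f p q \<in> QmuY \<mu>"
  unfolding bilinear_ext_def
  by (intro QmuY_sum QmuY_scale Qmu_mult assms(3))
    (use assms(1,2) in \<open>auto simp: QmuY_def subset_iff\<close>)

lemma QmuY_conc: "p \<in> QmuY \<mu> \<Longrightarrow> q \<in> QmuY \<mu> \<Longrightarrow> conc p q \<in> QmuY \<mu>"
  unfolding conc_def by (rule QmuY_bilinear_ext) (simp_all add: QmuY_word_elem)

text \<open>The partial fraction coefficients are rational, hence lie in \<open>Qmu \<mu>\<close>
  for every \<open>\<mu>\<close>.\<close>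

lemma QmuY_letter_prod:
  assumes "x \<in> Y" "y \<in> Y"
  shows "letter_prod x y \<in> QmuY \<mu>"
proof (cases x, cases y)
  fix k1 m1 k2 m2 assume "x = (k1, m1)" "y = (k2, m2)"
  then show ?thesis
    using assms
    by (auto simp: Y_def split: prod.split
        intro!: QmuY_word_elem QmuY_add QmuY_sum QmuY_scale Qmu_Rats)
qed

text \<open>The third term of the recursion carries the factor \<open>\<mu>\<close>, which lies in
  the coefficient ring as its generator.\<close>

lemma QmuY_stuffle_word:
  assumes "u \<in> lists Y" "v \<in> lists Y"
  shows "stuffle_word \<mu> u v \<in> QmuY \<mu>"
  using assms
proof (induction \<mu> u v rule: stuffle_word.induct)
  case (3 \<mu> u x v y)
  then show ?case
    by (auto intro!: QmuY_diff QmuY_add QmuY_scale QmuY_conc QmuY_word_elem QmuY_letter_prod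
        Qmu_generator)
qed (simp_all add: QmuY_word_elem)

lemma QmuY_stuffle: "p \<in> QmuY \<mu> \<Longrightarrow> q \<in> QmuY \<mu> \<Longrightarrow> stuffle \<mu> p q \<in> QmuY \<mu>"
  unfolding stuffle_def by (rule QmuY_bilinear_ext) (auto intro: QmuY_stuffle_word)

lemma keys_QmuY: "p \<in> QmuY \<mu> \<Longrightarrow> Poly_Mapping.keys p \<subseteq> lists Y"
  by (simp add: QmuY_def)

text \<open>Distributivity and the unit laws hold in the whole ambient space; commutativity and
  associativity use that supports lie in \<open>lists Y\<close>.\<close>

lemma cring_stuffle_algebra: "cring (stuffle_algebra \<mu>)"
proof (rule cringI)
  show "abelian_group (stuffle_algebra \<mu>)"
  proof (rule abelian_groupI)
    fix p assume "p \<in> carrier (stuffle_algebra \<mu>)"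
    then show "\<exists>q\<in>carrier (stuffle_algebra \<mu>).
        q \<oplus>\<^bsub>stuffle_algebra \<mu>\<^esub> p = \<zero>\<^bsub>stuffle_algebra \<mu>\<^esub>"
      using QmuY_uminus[of p \<mu>] by (intro bexI[of _ "- p"]) (simp_all add: stuffle_algebra_def)
  qed (simp_all add: stuffle_algebra_def QmuY_add QmuY_zero algebra_simps)
  show "Group.comm_monoid (stuffle_algebra \<mu>)"
    by (rule comm_monoidI)
      (auto simp: stuffle_algebra_def QmuY_stuffle QmuY_word_elem
        intro!: stuffle_assoc stuffle_commute dest!: keys_QmuY)
qed (simp add: stuffle_algebra_def stuffle_linear)

theorem theorem3p5:
  fixes \<mu> :: complex
  assumes "Re \<mu> > 0"
  shows "algebra (Qmu_ring \<mu>) (stuffle_algebra \<mu>)"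
  \<comment> \<open>What remains are the module laws and the compatibility of scalars with the
    product, which is bilinearity of \<open>stuffle\<close>.\<close>
  by (rule algebraI[OF cring_Qmu_ring cring_stuffle_algebra])
    (simp_all add: Qmu_ring_def stuffle_algebra_def QmuY_scale scale_add_left scale_add_right
      stuffle_linear)

end
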